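(* Let $\tau\ge1$ and $J\ge2$ be integers, let $F_0,F_1$ be continuous distributions on $\mathbb R$ with $\Delta:=|\theta-\frac12|>0$, where $\theta:=\mathbb P(X_0>X_1')$ for independent $X_0\sim F_0$, $X_1'\sim F_1$. Let $(B_t)_{t\ge1}$ be deterministic and positive, and let $\widehat D_0:=\inf\{t\ge1:\widehat M_t^{(J)}>B_t\}$, where $\widehat M_t^{(J)}$ is the unrestarted KT histogram process. Put $$b_{\tau,m}:=\frac1{\tau+m}\sum_{k=1}^m\frac{\tau}{\tau+k},\qquad \Lambda^{(0)}_{\tau,m,J}:=\log B_{\tau+m}+\frac{J-1}{2}\log(\tau+m+1)+C_J.$$ Then for every $m\ge1$, $$\mathbb P_\tau(\widehat D_0>\tau+m)\le\exp\Bigg[-\frac{2(\tau+m)}{7}\Bigg\{\Delta b_{\tau,m}-\frac1{2J}-\sqrt{\frac{[\Lambda^{(0)}_{\tau,m,J}]_+}{2(\tau+m)}}\Bigg\}_+^2\Bigg].$$ Consequently, for every post-change monitoring horizon $n\ge1$, $$\mathbb P_\tau(\widehat D_0>\tau+n)\le\inf_{1\le m\le n}\exp\Bigg[-\frac{2(\tau+m)}{7}\Bigg\{\Delta b_{\tau,m}-\frac1{2J}-\sqrt{\frac{[\Lambda^{(0)}_{\tau,m,J}]_+}{2(\tau+m)}}\Bigg\}_+^2\Bigg].$$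
   Context: Change-point model (law $\mathbb P_\tau$): $X_1,\ldots,X_\tau$ i.i.d. from $F_0$, $X_{\tau+1},X_{\tau+2},\ldots$ i.i.d. from $F_1$, the two samples independent, $U_1,U_2,\ldots$ i.i.d. $\mathrm{Unif}(0,1)$ independent of the $X$'s, and $$p_t=\frac{\sum_{r=1}^{t-1}\mathbf 1\{X_r>X_t\}+U_t}{t},\qquad t\ge1.$$ Bins: $I_j=[(j-1)/J,j/J)$ for $j=1,\ldots,J-1$ and $I_J=[(J-1)/J,1]$. Let $N_j(t):=\sum_{i=1}^t\mathbf 1\{p_i\in I_j\}$. The unrestarted Krichevsky–Trofimov (KT) histogram process is $\widehat M_0^{(J)}:=1$, $\widehat M_t^{(J)}:=\prod_{i=1}^t\widehat f_i^{(J)}(p_i)$, where $\widehat f_t^{(J)}(u):=J\,\dfrac{N_j(t-1)+1/2}{t-1+J/2}$ for $u\in I_j$. Constant $C_J$: for a block $u_1,\ldots,u_N\in[0,1]$ let $M_N^{\mathrm{KT}}(u_{1:N}):=\prod_{\ell=1}^NJ\dfrac{N_{\ell-1,j(u_\ell)}+1/2}{\ell-1+J/2}$, where $j(u)$ is the index of the bin containing $u$ and $N_{\ell-1,j}:=\sum_{r=1}^{\ell-1}\mathbf 1\{u_r\in I_j\}$; let $\widehat{\boldsymbol q}$ be the vector of empirical bin frequencies of the block and $\boldsymbol u_J=(1/J,\ldots,1/J)$. $C_J\ge0$ is a constant depending only on $J$ such that $\log M_N^{\mathrm{KT}}(u_{1:N})\ge N D_{\mathrm{KL}}(\widehat{\boldsymbol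 q}\|\boldsymbol u_J)-\frac{J-1}2\log(N+1)-C_J$ for all $N\ge1$ and all blocks (such a constant exists; natural logarithms). $(x)_+=[x]_+=\max(x,0)$, $\inf\varnothing=\infty$. *)

theory Defs
  imports "HOL-Probability.Probability"
begin

section \<open>Change-point model and conformal p-values\<close>

text \<open>
  The observations \<open>X t\<close> and the randomizers \<open>U t\<close> are indexed by \<open>t \<ge> 1\<close>; \<open>X 0\<close> and \<open>U 0\<close> are
  unconstrained and never used. The clause \<open>indep\<close> is mutual independence of the whole combined family
  \<open>X 1, X 2, \<dots>, U 1, U 2, \<dots>\<close>: the pre-change sample, the post-change sample and the randomizers
  are i.i.d. sequences that are independent of each other.
\<close>

locale change_point_model = prob_space M + F0: real_distribution F0 + F1: real_distribution F1
  for M :: "'a measure" and \<tau> :: nat and F0 F1 :: "real measure"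
    and X U :: "nat \<Rightarrow> 'a \<Rightarrow> real" +
  assumes indep: "indep_vars (\<lambda>_. borel) (case_sum X U) ({1..} <+> {1..})"
    and distr_pre: "\<And>t. 1 \<le> t \<Longrightarrow> t \<le> \<tau> \<Longrightarrow> distr M borel (X t) = F0"
    and distr_post: "\<And>t. \<tau> < t \<Longrightarrow> distr M borel (X t) = F1"
    and distr_unif: "\<And>t. 1 \<le> t \<Longrightarrow> distr M borel (U t) = uniform_measure lborel {0<..<1}"

definition pval :: "(nat \<Rightarrow> 'a \<Rightarrow> real) \<Rightarrow> (nat \<Rightarrow> 'a \<Rightarrow> real) \<Rightarrow> nat \<Rightarrow> 'a \<Rightarrow> real" where
  "pval X U t \<omega> = ((\<Sum>r = 1..<t. of_bool (X r \<omega> > X t \<omega>)) + U t \<omega>) / real t"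

definition exceed_prob :: "real measure \<Rightarrow> real measure \<Rightarrow> real" where
  "exceed_prob F0 F1 = measure (F0 \<Otimes>\<^sub>M F1) {z. fst z > snd z}"


section \<open>Krichevsky--Trofimov histogram process\<close>

definition bin :: "nat \<Rightarrow> nat \<Rightarrow> real set" where
  "bin J j = (if j = J then {(real J - 1) / real J .. 1}
              else {(real j - 1) / real J ..< real j / real J})"

text \<open>In all of the following, a sequence \<open>u\<close> is indexed from 1.\<close>

definition bin_count :: "nat \<Rightarrow> (nat \<Rightarrow> real) \<Rightarrow> nat \<Rightarrow> nat \<Rightarrow> real" where
  "bin_count J u t j = (\<Sum>i = 1..t. indicator (bin J j) (u i))"

text \<open>
  The sum selects the one bin containing \<open>x\<close>, see \<open>kt_density_bin\<close> below. The density is 0 for \<open>x\<close> outside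
  \<open>[0,1]\<close>, which is irrelevant: p-values lie in \<open>[0,1]\<close> almost surely. It is meant for \<open>t \<ge> 1\<close>.
\<close>

definition kt_density :: "nat \<Rightarrow> (nat \<Rightarrow> real) \<Rightarrow> nat \<Rightarrow> real \<Rightarrow> real" where
  "kt_density J u t x =
     (\<Sum>j = 1..J. indicator (bin J j) x *
        (real J * ((bin_count J u (t - 1) j + 1 / 2) / (real t - 1 + real J / 2))))"

text \<open>
  Applied to the p-value path this is the unrestarted process at time \<open>t\<close>; applied to a fixed
  block it is the block quantity that occurs in the definition of the regret constant.
\<close>

definition kt_process :: "nat \<Rightarrow> (nat \<Rightarrow> real) \<Rightarrow> nat \<Rightarrow> real" where
  "kt_process J u t = (\<Prod>i = 1..t. kt_density J u i (u i))"

definition kt_alarm :: "nat \<Rightarrow> (nat \<Rightarrow> real) \<Rightarrow> (nat \<Rightarrow> real) \<Rightarrow> enat" where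
  "kt_alarm J B u = (INF t\<in>{t. 1 \<le> t \<and> kt_process J u t > B t}. enat t)"


section \<open>The regret constant\<close>

definition emp_freq :: "nat \<Rightarrow> (nat \<Rightarrow> real) \<Rightarrow> nat \<Rightarrow> nat \<Rightarrow> real" where
  "emp_freq J u N j = bin_count J u N j / real N"

text \<open>
  Vectors indexed by the bins are regarded as measures on \<open>{1..J}\<close>. The library's
  \<open>KL_divergence b P Q\<close> has the reference measure \<open>P\<close> first, so it is the divergence of \<open>Q\<close> from \<open>P\<close>;
  base \<open>exp 1\<close> gives natural logarithms. See \<open>kl_unif_eq\<close> below for the finite sum.
\<close>

definition kl_unif :: "nat \<Rightarrow> (nat \<Rightarrow> real) \<Rightarrow> real" where
  "kl_unif J q = KL_divergence (exp 1) (point_measure {1..J} (\<lambda>j. ennreal (1 / real J)))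
                                       (point_measure {1..J} (\<lambda>j. ennreal (q j)))"

definition kt_regret_constant :: "nat \<Rightarrow> real \<Rightarrow> bool" where
  "kt_regret_constant J C \<longleftrightarrow> 0 \<le> C \<and>
     (\<forall>N \<ge> 1. \<forall>u. (\<forall>l\<in>{1..N}. u l \<in> {0..1}) \<longrightarrow>
        ln (kt_process J u N)
          \<ge> real N * kl_unif J (emp_freq J u N) - (real J - 1) / 2 * ln (real N + 1) - C)"


section \<open>Quantities in the delay bound\<close>

definition delay_weight :: "nat \<Rightarrow> nat \<Rightarrow> real" where
  "delay_weight \<tau> m = 1 / (real \<tau> + real m) * (\<Sum>k = 1..m. real \<tau> / (real \<tau> + real k))"

definition log_threshold :: "(nat \<Rightarrow> real) \<Rightarrow> real \<Rightarrow> nat \<Rightarrow> nat \<Rightarrow> nat \<Rightarrow> real" where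
  "log_threshold B C \<tau> m J =
     ln (B (\<tau> + m)) + (real J - 1) / 2 * ln (real \<tau> + real m + 1) + C"


section \<open>Sanity checks for the encodings\<close>

lemma bin_disjoint:
  assumes "1 \<le> i" "i < j" "j \<le> J"
  shows "bin J i \<inter> bin J j = {}"
proof -
  have "real i / real J \<le> (real j - 1) / real J"
    using assms by (intro divide_right_mono) auto
  then show ?thesis
    using assms by (auto simp: bin_def)
qed

lemma Un_bin:
  assumes "1 \<le> J"
  shows "(\<Union>j\<in>{1..J}. bin J j) = {0..1}"
proof (intro equalityI subsetI)
  fix x assume "x \<in> (\<Union>j\<in>{1..J}. bin J j)"
  then obtain j where j: "1 \<le> j" "j \<le> J" "x \<in> bin J j" by auto
  have "0 \<le> (real j - 1) / real J" "real j / real J \<le> 1"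
    using j by auto
  moreover have "(real j - 1) / real J \<le> x" "x \<le> 1 \<or> x < real j / real J"
    using j by (auto simp: bin_def split: if_splits)
  ultimately show "x \<in> {0..1}"
    by auto
next
  fix x :: real assume x: "x \<in> {0..1}"
  show "x \<in> (\<Union>j\<in>{1..J}. bin J j)"
  proof (cases "x * real J < real J - 1")
    case True
    define j where "j = nat \<lfloor>x * real J\<rfloor> + 1"
    have "real j - 1 = of_int \<lfloor>x * real J\<rfloor>"
      using x by (simp add: j_def)
    then have "real j - 1 \<le> x * real J" "x * real J < real j"
      by linarith+
    moreover from this True have "1 \<le> j" "j < J" by (auto simp: j_def)
    ultimately have "x \<in> bin J j"
      using assms by (auto simp: bin_def field_simps)
    then show ?thesis using \<open>1 \<le> j\<close> \<open>j < J\<close> by auto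
  next
    case False
    then have "x \<in> bin J J" using x assms by (auto simp: bin_def field_simps)
    then show ?thesis using assms by auto
  qed
qed

lemma kt_density_bin:
  assumes "j \<in> {1..J}" "x \<in> bin J j"
  shows "kt_density J u t x =
    real J * ((bin_count J u (t - 1) j + 1 / 2) / (real t - 1 + real J / 2))"
proof -
  have "indicator (bin J i) x = (of_bool (i = j) :: real)" if "i \<in> {1..J}" for i
    using assms that bin_disjoint[of i j J] bin_disjoint[of j i J]
    by (cases i j rule: linorder_cases) (auto simp: indicator_def)
  then have "kt_density J u t x = (\<Sum>i = 1..J. of_bool (i = j) *
      (real J * ((bin_count J u (t - 1) i + 1 / 2) / (real t - 1 + real J / 2))))"
    unfolding kt_density_def by (intro sum.cong) simp_all
  also have "\<dots> = real J * ((bin_count J u (t - 1) j + 1 / 2) / (real t - 1 + real J / 2))"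
    using assms by (subst sum.remove[of _ j]) auto
  finally show ?thesis .
qed

lemma kl_unif_eq:
  assumes "1 \<le> J" "\<And>j. j \<in> {1..J} \<Longrightarrow> 0 \<le> q j"
  shows "kl_unif J q = (\<Sum>j = 1..J. q j * ln (q j / (1 / real J)))"
proof -
  interpret sigma_finite_measure "count_space {1..J}"
    by (rule sigma_finite_measure_count_space_finite) simp
  have "kl_unif J q = (\<integral>j. q j * log (exp 1) (q j / (1 / real J)) \<partial>count_space {1..J})"
    unfolding kl_unif_def point_measure_def using assms
    by (intro KL_density_density) (auto simp: AE_count_space)
  also have "\<dots> = (\<Sum>j = 1..J. q j * ln (q j / (1 / real J)))"
    by (simp add: lebesgue_integral_count_space_finite log_def)
  finally show ?thesis .
qed

end

theory Submission
  imports Defs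
begin

text \<open>
  If there is no alarm up to time \<open>N = \<tau> + m\<close>, then the KT wealth at \<open>N\<close> is at most \<open>B N\<close>, so the regret
  bound limits the divergence of the empirical bin frequencies from uniform. A Pinsker-type inequality
  turns this into a bound on the deviation of the empirical mean of the p-values from 1/2, up to the
  discretization error 1/(2J). On the other hand, the expected mean differs from 1/2 by exactly
  \<open>\<Delta> * delay_weight \<tau> m\<close>, because each post-change p-value compares with \<open>\<tau>\<close> pre-change observations.
  The sum of the p-values is a function of independent variables: changing \<open>X i\<close> moves it by at most
  \<open>1 + (\<Sum>t = i + 1..N. 1 / t)\<close> and changing \<open>U i\<close> by at most 1. The squares of these constants
  sum to at most \<open>7 N\<close>, and McDiarmid's inequality gives the exponent.
\<close>

section \<open>McDiarmid's inequality\<close>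

lemma Hoeffdings_lemma_oscillation:
  fixes f :: "'a \<Rightarrow> real"
  assumes "prob_space M" and [measurable]: "f \<in> borel_measurable M"
    and osc: "\<And>x y. x \<in> space M \<Longrightarrow> y \<in> space M \<Longrightarrow> \<bar>f x - f y\<bar> \<le> c"
    and "0 < l"
  shows "(\<integral>x. exp (l * (f x - (\<integral>x. f x \<partial>M))) \<partial>M) \<le> exp (l\<^sup>2 * c\<^sup>2 / 8)"
proof -
  interpret prob_space M by fact
  define a where "a = Inf (f ` space M)"
  obtain x0 where x0: "x0 \<in> space M" using not_empty by auto
  have bdd: "bdd_below (f ` space M)"
  proof (rule bdd_belowI2)
    show "f x0 - c \<le> f x" if "x \<in> space M" for x
      using osc[OF x0 that] by linarith
  qed
  have range: "a \<le> f x \<and> f x \<le> a + c" if x: "x \<in> space M" for x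
  proof
    show "a \<le> f x" unfolding a_def using bdd x by (intro cInf_lower) auto
    have "f x - c \<le> a" unfolding a_def
    proof (rule cInf_greatest)
      show "f ` space M \<noteq> {}" using x by auto
      show "f x - c \<le> z" if "z \<in> f ` space M" for z
        using that osc[OF x] by fastforce
    qed
    then show "f x \<le> a + c" by simp
  qed
  then interpret interval_bounded_random_variable M f a "a + c"
    by unfold_locales auto
  have bound: "norm (exp (l * (f x - expectation f))) \<le> exp (l * (a + c - expectation f))" if "x \<in> space M" for x
    using range[OF that] \<open>0 < l\<close>
    by (simp add: mult_left_mono)
  have "integrable M (\<lambda>x. exp (l * (f x - expectation f)))"
    by (rule integrable_const_bound[where B = "exp (l * (a + c - expectation f))"])
      (use bound in auto)
  then have "ennreal (\<integral>x. exp (l * (f x - expectation f)) \<partial>M) =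
      (\<integral>\<^sup>+x. ennreal (exp (l * (f x - expectation f))) \<partial>M)"
    by (intro nn_integral_eq_integral[symmetric]) auto
  also have "\<dots> \<le> ennreal (exp (l\<^sup>2 * c\<^sup>2 / 8))"
    using Hoeffdings_lemma_nn_integral[OF \<open>0 < l\<close>] by simp
  finally show ?thesis by simp
qed

text \<open>Induction on the coordinates, with Fubini in place of a Doob martingale. With the other
  coordinates frozen, Hoeffding's lemma in coordinate \<open>i\<close> gives the factor
  \<open>exp (l\<^sup>2 * (c i)\<^sup>2 / 8)\<close>. The partial average \<open>g\<close> over that
  coordinate inherits the bound \<open>K\<close>, the remaining difference constants and the mean of
  \<open>f\<close>, so the induction hypothesis applies to it. The bound \<open>K\<close> serves
  integrability and does not enter the estimate.\<close>

lemma bounded_differences_mgf: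
  fixes N :: "'i \<Rightarrow> 'b measure" and f :: "('i \<Rightarrow> 'b) \<Rightarrow> real"
  assumes prob: "\<And>i. prob_space (N i)" and "finite I" and "0 < l"
    and "f \<in> borel_measurable (PiM I N)"
    and "\<And>x. x \<in> space (PiM I N) \<Longrightarrow> \<bar>f x\<bar> \<le> K"
    and "\<And>i x y. i \<in> I \<Longrightarrow> x \<in> space (PiM I N) \<Longrightarrow> y \<in> space (N i) \<Longrightarrow>
           \<bar>f (x(i := y)) - f x\<bar> \<le> c i"
  shows "(\<integral>x. exp (l * (f x - (\<integral>x. f x \<partial>PiM I N))) \<partial>PiM I N) \<le> exp (l\<^sup>2 * (\<Sum>i\<in>I. (c i)\<^sup>2) / 8)"
  using assms(2,4-)
proof (induction I arbitrary: f rule: finite_induct)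
  case empty
  interpret product_prob_space N "{}"
    using prob by (simp add: product_prob_space_def product_prob_space_axioms_def
      product_sigma_finite_def prob_space_imp_sigma_finite)
  show ?case by (simp add: PiM_empty lebesgue_integral_count_space_finite)
next
  case (insert i I)
  interpret Ni: prob_space "N i" by (rule prob)
  interpret product_prob_space N I
    using prob by (simp add: product_prob_space_def product_prob_space_axioms_def
      product_sigma_finite_def prob_space_imp_sigma_finite)
  let ?P = "PiM I N" and ?P' = "PiM (insert i I) N"
  interpret P': product_prob_space N "insert i I" ..
  note f [measurable] = insert.prems(1)
  note bound = insert.prems(2) and diff = insert.prems(3)
  have upd: "x(i := y) \<in> space ?P'" if "x \<in> space ?P" "y \<in> space (N i)" for x y
    using that by (auto simp: space_PiM PiE_def extensional_def)
  have upd_meas [measurable]: "(\<lambda>p. f ((fst p)(i := snd p))) \<in> borel_measurable (?P \<Otimes>\<^sub>M N i)"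
    using measurable_compose[OF measurable_add_dim f] by (simp add: case_prod_beta)
  define g where "g x = (\<integral>y. f (x(i := y)) \<partial>N i)" for x
  have g_meas [measurable]: "g \<in> borel_measurable ?P"
    unfolding g_def by (rule Ni.borel_measurable_lebesgue_integral) (simp add: case_prod_beta)
  have sec: "(\<lambda>y. f (x(i := y))) \<in> borel_measurable (N i)" if "x \<in> space ?P" for x
    using measurable_compose[OF measurable_Pair1'[OF that] upd_meas] by simp
  have int_sec: "integrable (N i) (\<lambda>y. f (x(i := y)))" if "x \<in> space ?P" for x
    by (rule Ni.integrable_const_bound[where B = K]) (use sec that bound upd in auto)
  have g_bound: "\<bar>g x\<bar> \<le> K" if "x \<in> space ?P" for x
  proof -
    have "\<bar>g x\<bar> \<le> (\<integral>y. \<bar>f (x(i := y))\<bar> \<partial>N i)"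
      unfolding g_def by (rule integral_abs_bound)
    also have "\<dots> \<le> (\<integral>y. K \<partial>N i)"
      by (intro integral_mono integrable_abs int_sec) (use that bound upd in auto)
    finally show ?thesis by (simp add: Ni.prob_space)
  qed
  have g_diff: "\<bar>g (x(j := z)) - g x\<bar> \<le> c j" if "j \<in> I" "x \<in> space ?P" "z \<in> space (N j)" for j x z
  proof -
    have ij: "i \<noteq> j" using that insert.hyps by auto
    have xz: "x(j := z) \<in> space ?P" 
      using that by (auto simp: space_PiM PiE_def extensional_def)
    have "g (x(j := z)) - g x = (\<integral>y. f (x(j := z, i := y)) - f (x(i := y)) \<partial>N i)"
      unfolding g_def using int_sec[OF xz] int_sec[OF that(2)] by simp
    also have "\<bar>\<dots>\<bar> \<le> (\<integral>y. \<bar>f (x(j := z, i := y)) - f (x(i := y))\<bar> \<partial>N i)"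
      by (rule integral_abs_bound)
    also have "\<dots> \<le> (\<integral>y. c j \<partial>N i)"
    proof (intro integral_mono integrable_abs Bochner_Integration.integrable_diff int_sec xz that)
      show "\<bar>f (x(j := z, i := y)) - f (x(i := y))\<bar> \<le> c j" if "y \<in> space (N i)" for y
        using diff[OF _ upd[OF \<open>x \<in> space ?P\<close> that] \<open>z \<in> space (N j)\<close>] \<open>j \<in> I\<close>
        unfolding fun_upd_twist[OF ij] by blast
    qed auto
    finally show ?thesis by (simp add: Ni.prob_space)
  qed
  have "integrable ?P' f"
    by (rule P'.P.integrable_const_bound[where B = K]) (use bound in auto)
  then have mean: "(\<integral>x. f x \<partial>?P') = (\<integral>x. g x \<partial>?P)"
    unfolding g_def using insert.hyps by (intro product_integral_insert)
  let ?e = "\<integral>x. g x \<partial>?P"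
  have "integrable ?P' (\<lambda>x. exp (l * (f x - ?e)))"
  proof (rule P'.P.integrable_const_bound[where B = "exp (l * (K - ?e))"])
    show "AE x in ?P'. norm (exp (l * (f x - ?e))) \<le> exp (l * (K - ?e))"
    proof (rule AE_I2)
      show "norm (exp (l * (f x - ?e))) \<le> exp (l * (K - ?e))" if "x \<in> space ?P'" for x
        using bound[OF that] \<open>0 < l\<close> by (simp add: mult_left_mono)
    qed
  qed measurable
  then have "(\<integral>x. exp (l * (f x - ?e)) \<partial>?P') =
      (\<integral>x. (\<integral>y. exp (l * (f (x(i := y)) - ?e)) \<partial>N i) \<partial>?P)"
    by (rule product_integral_insert[OF insert.hyps])
  also have "\<dots> \<le> (\<integral>x. exp (l * (g x - ?e)) * exp (l\<^sup>2 * (c i)\<^sup>2 / 8) \<partial>?P)"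
  proof (rule integral_mono')
    show "integrable ?P (\<lambda>x. exp (l * (g x - ?e)) * exp (l\<^sup>2 * (c i)\<^sup>2 / 8))"
    proof (intro integrable_mult_left impI P.integrable_const_bound[where B = "exp (l * (K - ?e))"] AE_I2)
      show "norm (exp (l * (g x - ?e))) \<le> exp (l * (K - ?e))" if "x \<in> space ?P" for x
        using g_bound[OF that] \<open>0 < l\<close> by (simp add: mult_left_mono)
    qed measurable
  next
    fix x assume x: "x \<in> space ?P"
    \<comment> \<open>The factor with \<open>g x\<close> is constant in \<open>y\<close>, and
      \<open>g x\<close> is the mean of the section, so the other factor is the centred transform of
      Hoeffding's lemma.\<close>
    have "(\<integral>y. exp (l * (f (x(i := y)) - ?e)) \<partial>N i) =
        (\<integral>y. exp (l * (g x - ?e)) * exp (l * (f (x(i := y)) - g x)) \<partial>N i)"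
      by (simp add: algebra_simps flip: exp_add)
    also have "\<dots> = exp (l * (g x - ?e)) * (\<integral>y. exp (l * (f (x(i := y)) - g x)) \<partial>N i)"
      by simp
    also have "(\<integral>y. exp (l * (f (x(i := y)) - g x)) \<partial>N i) \<le> exp (l\<^sup>2 * (c i)\<^sup>2 / 8)"
      unfolding g_def
    proof (rule Hoeffdings_lemma_oscillation[OF prob sec[OF x] _ \<open>0 < l\<close>])
      show "\<bar>f (x(i := y)) - f (x(i := z))\<bar> \<le> c i" if "y \<in> space (N i)" "z \<in> space (N i)" for y z
        using diff[OF _ upd[OF x that(2)] that(1)] unfolding fun_upd_upd by blast
    qed
    finally show "(\<integral>y. exp (l * (f (x(i := y)) - ?e)) \<partial>N i) \<le>
        exp (l * (g x - ?e)) * exp (l\<^sup>2 * (c i)\<^sup>2 / 8)"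
      by simp
  qed simp
  also have "\<dots> = (\<integral>x. exp (l * (g x - ?e)) \<partial>?P) * exp (l\<^sup>2 * (c i)\<^sup>2 / 8)"
    by simp
  also have "\<dots> \<le> exp (l\<^sup>2 * (\<Sum>i\<in>I. (c i)\<^sup>2) / 8) * exp (l\<^sup>2 * (c i)\<^sup>2 / 8)"
    by (intro mult_right_mono insert.IH g_meas g_bound g_diff) auto
  also have "\<dots> = exp (l\<^sup>2 * (\<Sum>i\<in>insert i I. (c i)\<^sup>2) / 8)"
    using insert.hyps by (simp add: algebra_simps add_divide_distrib flip: exp_add)
  finally show ?case unfolding mean .
qed

text \<open>Chernoff's method: independence identifies the joint law of the \<open>Z i\<close> with
  a product measure, on which the previous lemma bounds the exponential moment, and Markov's
  inequality gives the tail. Stating the result with an upper bound \<open>v\<close> for the sum of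
  squares spares the user its exact value.\<close>

lemma (in prob_space) McDiarmid_inequality:
  fixes Z :: "'i \<Rightarrow> 'a \<Rightarrow> 'b" and f :: "('i \<Rightarrow> 'b) \<Rightarrow> real"
  assumes I: "finite I" "I \<noteq> {}" and indep: "indep_vars N Z I"
    and f [measurable]: "f \<in> borel_measurable (PiM I N)"
    and bound: "\<And>x. x \<in> space (PiM I N) \<Longrightarrow> \<bar>f x\<bar> \<le> K"
    and diff: "\<And>i x y. i \<in> I \<Longrightarrow> x \<in> space (PiM I N) \<Longrightarrow> y \<in> space (N i) \<Longrightarrow>
           \<bar>f (x(i := y)) - f x\<bar> \<le> c i"
    and v: "(\<Sum>i\<in>I. (c i)\<^sup>2) \<le> v" "0 < v" and "0 \<le> \<epsilon>"
  shows "prob {\<omega> \<in> space M. f (\<lambda>i\<in>I. Z i \<omega>) \<ge> expectation (\<lambda>\<omega>. f (\<lambda>i\<in>I. Z i \<omega>)) + \<epsilon>}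
    \<le> exp (- 2 * \<epsilon>\<^sup>2 / v)"
proof (cases "\<epsilon> = 0")
  \<comment> \<open>The right-hand side is 1 here. This case is separate because the choice of
    \<open>l\<close> below is positive only for positive \<epsilon>.\<close>
  case True
  then show ?thesis by simp
next
  case False
  then have "0 < \<epsilon>" using \<open>0 \<le> \<epsilon>\<close> by simp
  have rv: "random_variable (N i) (Z i)" if "i \<in> I" for i
    using indep that by (auto simp: indep_vars_def)
  then have [measurable]: "(\<lambda>\<omega>. \<lambda>i\<in>I. Z i \<omega>) \<in> M \<rightarrow>\<^sub>M PiM I N"
    by measurable
  obtain i0 where "i0 \<in> I" using I by auto
  \<comment> \<open>\<open>product_prob_space\<close> needs a probability measure at every index, also outside \<open>I\<close>.\<close>
  define N' where "N' i = distr M (N (if i \<in> I then i else i0)) (Z (if i \<in> I then i else i0))" for i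
  have prob: "prob_space (N' i)" for i
    unfolding N'_def using rv \<open>i0 \<in> I\<close> by (intro prob_space_distr) auto
  have "distr M (PiM I N) (\<lambda>\<omega>. \<lambda>i\<in>I. Z i \<omega>) = PiM I (\<lambda>i. distr M (N i) (Z i))"
    using indep_vars_iff_distr_eq_PiM'[OF I(2) rv] indep by simp
  also have "\<dots> = PiM I N'" by (intro PiM_cong) (simp_all add: N'_def)
  finally have distr: "distr M (PiM I N) (\<lambda>\<omega>. \<lambda>i\<in>I. Z i \<omega>) = PiM I N'" .
  have sets: "sets (PiM I N') = sets (PiM I N)" by (simp flip: distr)
  have space: "space (PiM I N') = space (PiM I N)" by (simp flip: distr)
  let ?F = "\<lambda>\<omega>. f (\<lambda>i\<in>I. Z i \<omega>)"
  \<comment> \<open>The minimiser of the Chernoff exponent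
    \<open>l\<^sup>2 * v / 8 - l * \<epsilon>\<close>.\<close>
  define l where "l = 4 * \<epsilon> / v"
  have "0 < l" using \<open>0 < \<epsilon>\<close> v by (simp add: l_def)
  have space_Z: "(\<lambda>i\<in>I. Z i \<omega>) \<in> space (PiM I N)" if "\<omega> \<in> space M" for \<omega>
    using that by (rule measurable_space[rotated]) measurable
  have mean: "(\<integral>x. f x \<partial>PiM I N') = expectation ?F"
    by (simp add: integral_distr flip: distr)
  have "expectation (\<lambda>\<omega>. exp (l * (?F \<omega> - expectation ?F))) =
      (\<integral>x. exp (l * (f x - (\<integral>x. f x \<partial>PiM I N'))) \<partial>PiM I N')"
    unfolding mean by (simp add: integral_distr flip: distr)
  also have "\<dots> \<le> exp (l\<^sup>2 * (\<Sum>i\<in>I. (c i)\<^sup>2) / 8)"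
  proof (rule bounded_differences_mgf[OF prob I(1) \<open>0 < l\<close>])
    show "f \<in> borel_measurable (PiM I N')" using f by (simp cong: measurable_cong_sets add: sets)
    show "\<bar>f x\<bar> \<le> K" if "x \<in> space (PiM I N')" for x using bound that space by simp
    show "\<bar>f (x(i := y)) - f x\<bar> \<le> c i"
      if "i \<in> I" "x \<in> space (PiM I N')" "y \<in> space (N' i)" for i x y
      using that diff space by (simp add: N'_def)
  qed
  also have "\<dots> \<le> exp (l\<^sup>2 * v / 8)" using v by (simp add: mult_left_mono)
  finally have mgf: "expectation (\<lambda>\<omega>. exp (l * (?F \<omega> - expectation ?F))) \<le> exp (l\<^sup>2 * v / 8)" .
  have "{\<omega> \<in> space M. ?F \<omega> \<ge> expectation ?F + \<epsilon>} =
      {\<omega> \<in> space M. exp (l * (?F \<omega> - expectation ?F)) \<ge> exp (l * \<epsilon>)}"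
    using \<open>0 < l\<close> by auto
  also have "prob \<dots> \<le> expectation (\<lambda>\<omega>. exp (l * (?F \<omega> - expectation ?F))) / exp (l * \<epsilon>)"
  proof (rule integral_Markov_inequality_measure)
    show "integrable M (\<lambda>\<omega>. exp (l * (?F \<omega> - expectation ?F)))"
    proof (rule integrable_const_bound[where B = "exp (l * (K - expectation ?F))"], rule AE_I2)
      show "norm (exp (l * (?F \<omega> - expectation ?F))) \<le> exp (l * (K - expectation ?F))"
        if "\<omega> \<in> space M" for \<omega>
        using bound[OF space_Z[OF that]] \<open>0 < l\<close> by (simp add: mult_left_mono)
    qed measurable
  qed auto
  also have "\<dots> \<le> exp (l\<^sup>2 * v / 8) / exp (l * \<epsilon>)"
    using mgf by (simp add: divide_right_mono)
  also have "\<dots> = exp (l\<^sup>2 * v / 8 - l * \<epsilon>)" by (simp add: exp_diff)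
  also have "l\<^sup>2 * v / 8 - l * \<epsilon> = - 2 * \<epsilon>\<^sup>2 / v"
    using v by (simp add: l_def power2_eq_square field_simps)
  finally show ?thesis .
qed

section \<open>From relative entropy to the empirical mean\<close>

text \<open>Pinsker's inequality in the form needed for means of a test function with values in the
  unit interval. By convex duality, a log-moment generating function of at most
  \<open>l\<^sup>2 / 8\<close> forces the divergence to be at least twice the squared shift of the
  mean.\<close>

lemma kl_unif_mean_deviation:
  assumes "1 \<le> J" and q: "\<And>j. j \<in> {1..J} \<Longrightarrow> 0 \<le> q j" "(\<Sum>j = 1..J. q j) = 1"
    and h: "\<And>j. j \<in> {1..J} \<Longrightarrow> h j \<in> {0..1}"
  shows "((\<Sum>j = 1..J. q j * h j) - (\<Sum>j = 1..J. h j) / real J)\<^sup>2 \<le> kl_unif J q / 2"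
proof -
  \<comment> \<open>Donsker--Varadhan inequality for the test function \<open>l * h\<close>, with Hoeffding's lemma for its
    log-moment generating function.\<close>
  have variational: "l * ((\<Sum>j = 1..J. q j * h j) - (\<Sum>j = 1..J. h j) / real J) \<le> kl_unif J q + l\<^sup>2 / 8"
    if "0 < l" and h: "\<And>j. j \<in> {1..J} \<Longrightarrow> h j \<in> {0..1}" for l :: real and h :: "nat \<Rightarrow> real"
  proof -
    define \<mu> where "\<mu> = (\<Sum>j = 1..J. h j) / real J"
    define w where "w j = exp (l * (h j - \<mu>))" for j
    define A where "A = (\<Sum>j = 1..J. w j) / real J"
    have "0 < (\<Sum>j = 1..J. w j)"
      using \<open>1 \<le> J\<close> by (intro sum_pos) (auto simp: w_def)
    then have "0 < A" using \<open>1 \<le> J\<close> by (simp add: A_def)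
    let ?U = "uniform_count_measure {1..J}"
    have integral_U: "(\<integral>j. g j \<partial>?U) = (\<Sum>j = 1..J. g j) / real J" for g :: "nat \<Rightarrow> real"
      by (simp add: integral_uniform_count_measure)
    have "(\<integral>j. exp (l * (h j - (\<integral>j. h j \<partial>?U))) \<partial>?U) \<le> exp (l\<^sup>2 * 1\<^sup>2 / 8)"
    proof (rule Hoeffdings_lemma_oscillation)
      show "prob_space ?U" using \<open>1 \<le> J\<close> by (intro prob_space_uniform_count_measure) auto
      show "h \<in> borel_measurable ?U" by (simp add: measurable_def sets_uniform_count_measure space_uniform_count_measure)
      show "\<bar>h i - h j\<bar> \<le> 1" if "i \<in> space ?U" "j \<in> space ?U" for i j
        using h[of i] h[of j] that by (auto simp: space_uniform_count_measure)
    qed fact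
    then have "A \<le> exp (l\<^sup>2 / 8)" by (simp only: integral_U A_def w_def \<mu>_def power_one mult_1_right)
    then have "ln A \<le> l\<^sup>2 / 8" using \<open>0 < A\<close> ln_le_cancel_iff[of A "exp (l\<^sup>2 / 8)"] by simp
    \<comment> \<open>The numbers \<open>w j / (real J * A)\<close> are the uniform weights tilted
      by \<open>exp (l * h j)\<close> and normalised. This is \<open>ln x \<le> x - 1\<close> for
      the ratio of the tilted weight to \<open>q j\<close>, multiplied by \<open>q j\<close>. Both
      the tilted weights and \<open>q\<close> sum to 1, so the right-hand sides sum to 0.\<close>
    have gibbs: "q j * (l * (h j - \<mu>)) - q j * ln (q j / (1 / real J)) - q j * ln A \<le> w j / (real J * A) - q j"
      if "j \<in> {1..J}" for j
    proof (cases "q j = 0")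
      case True
      then show ?thesis using \<open>0 < A\<close> by (simp add: w_def)
    next
      case False
      then have "0 < q j" using q that by force
      have pos: "0 < w j / (q j * real J * A)"
        using \<open>0 < q j\<close> \<open>0 < A\<close> \<open>1 \<le> J\<close> by (simp add: w_def)
      have "ln (w j / (q j * real J * A)) = l * (h j - \<mu>) - ln (q j / (1 / real J)) - ln A"
        using \<open>0 < q j\<close> \<open>0 < A\<close> \<open>1 \<le> J\<close> by (simp add: w_def ln_div ln_mult)
      then have "l * (h j - \<mu>) - ln (q j / (1 / real J)) - ln A \<le> w j / (q j * real J * A) - 1"
        using ln_le_minus_one[OF pos] by simp
      then have "q j * (l * (h j - \<mu>) - ln (q j / (1 / real J)) - ln A) \<le> q j * (w j / (q j * real J * A) - 1)"
        using \<open>0 < q j\<close> by (intro mult_left_mono) auto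
      also have "\<dots> = w j / (real J * A) - q j"
        using \<open>0 < q j\<close> by (simp add: field_simps)
      finally show ?thesis by (simp add: algebra_simps)
    qed
    have "(\<Sum>j = 1..J. q j * (l * (h j - \<mu>))) = l * (\<Sum>j = 1..J. q j * h j) - l * \<mu> * (\<Sum>j = 1..J. q j)"
      by (simp add: sum_distrib_left sum_subtractf algebra_simps)
    moreover have "(\<Sum>j = 1..J. q j * ln A) = ln A"
      using q(2) by (simp flip: sum_distrib_right)
    ultimately have "l * ((\<Sum>j = 1..J. q j * h j) - \<mu>) - kl_unif J q - ln A =
        (\<Sum>j = 1..J. q j * (l * (h j - \<mu>)) - q j * ln (q j / (1 / real J)) - q j * ln A)"
      using q(2) kl_unif_eq[OF \<open>1 \<le> J\<close> q(1)] by (simp add: sum_subtractf right_diff_distrib)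
    also have "\<dots> \<le> (\<Sum>j = 1..J. w j / (real J * A) - q j)"
      by (rule sum_mono) (rule gibbs)
    also have "\<dots> = (\<Sum>j = 1..J. w j) / (real J * A) - 1"
      using q(2) by (simp add: sum_subtractf flip: sum_divide_distrib)
    also have "\<dots> = 0" using \<open>0 < (\<Sum>j = 1..J. w j)\<close> \<open>1 \<le> J\<close> unfolding A_def by simp
    finally show ?thesis using \<open>ln A \<le> l\<^sup>2 / 8\<close> unfolding \<mu>_def by simp
  qed
  define d where "d = (\<Sum>j = 1..J. q j * h j) - (\<Sum>j = 1..J. h j) / real J"
  have "\<bar>d\<bar> * l \<le> kl_unif J q + l\<^sup>2 / 8" if "0 < l" for l
  proof (cases "0 \<le> d")
    case True
    have "l * d \<le> kl_unif J q + l\<^sup>2 / 8"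
      unfolding d_def using that h by (rule variational)
    then show ?thesis using True by (simp add: mult.commute)
  next
    \<comment> \<open>The function \<open>1 - h\<close> also takes values in the unit interval and
      has deviation \<open>- d\<close>, which covers the other sign.\<close>
    case False
    have "(\<Sum>j = 1..J. q j * (1 - h j)) - (\<Sum>j = 1..J. 1 - h j) / real J = - d"
      using q(2) \<open>1 \<le> J\<close> by (simp add: d_def sum_subtractf right_diff_distrib diff_divide_distrib)
    moreover have "l * ((\<Sum>j = 1..J. q j * (1 - h j)) - (\<Sum>j = 1..J. 1 - h j) / real J) \<le> kl_unif J q + l\<^sup>2 / 8"
      using h by (intro variational that) auto
    ultimately show ?thesis using False by (simp add: mult.commute)
  qed
  \<comment> \<open>The choice \<open>l = 4 * \<bar>d\<bar>\<close> is optimal.\<close>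
  from this[of "4 * \<bar>d\<bar>"] have "d\<^sup>2 \<le> kl_unif J q / 2" if "d \<noteq> 0"
    using that by (simp add: power2_eq_square)
  \<comment> \<open>This settles the case \<open>d = 0\<close>. The zero test function bounds the
    divergence below by \<open>- l\<^sup>2 / 8\<close>, and \<open>l = sqrt (8 * e)\<close> makes
    this \<open>- e\<close>.\<close>
  moreover have "0 \<le> kl_unif J q"
  proof (rule field_le_epsilon)
    fix e :: real assume "0 < e"
    then show "0 \<le> kl_unif J q + e"
      using variational[of "sqrt (8 * e)" "\<lambda>_. 0"] by simp
  qed
  ultimately show ?thesis unfolding d_def[symmetric] by fastforce
qed

lemma sum_indicator_bin:
  assumes "j \<in> {1..J}" "x \<in> bin J j"
  shows "(\<Sum>i = 1..J. indicator (bin J i) x * g i) = (g j :: real)"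
proof -
  have "indicator (bin J i) x = (of_bool (i = j) :: real)" if "i \<in> {1..J}" for i
    using assms that bin_disjoint[of i j J] bin_disjoint[of j i J]
    by (cases i j rule: linorder_cases) (auto simp: indicator_def)
  then have "(\<Sum>i = 1..J. indicator (bin J i) x * g i) = (\<Sum>i = 1..J. of_bool (i = j) * g i)"
    by (intro sum.cong) simp_all
  also have "\<dots> = g j" using assms by (subst sum.remove[of _ j]) auto
  finally show ?thesis .
qed

lemma sum_emp_freq:
  "(\<Sum>j = 1..J. emp_freq J u N j * g j) = (\<Sum>i = 1..N. \<Sum>j = 1..J. indicator (bin J j) (u i) * g j) / real N"
  unfolding emp_freq_def bin_count_def
  by (simp only: sum_divide_distrib sum_distrib_right times_divide_eq_left) (rule sum.swap)

text \<open>The pseudo-count 1/2 keeps every factor positive even when the bin was empty so far.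
  Positivity allows an upper bound on the wealth to be passed through the logarithm.\<close>

lemma kt_process_pos:
  assumes "2 \<le> J" "\<And>i. i \<in> {1..N} \<Longrightarrow> u i \<in> {0..1}"
  shows "0 < kt_process J u N"
  unfolding kt_process_def
proof (rule prod_pos)
  fix i assume i: "i \<in> {1..N}"
  then have "u i \<in> (\<Union>j\<in>{1..J}. bin J j)"
    using assms by (subst Un_bin) auto
  then obtain j where j: "j \<in> {1..J}" "u i \<in> bin J j" by blast
  have "0 \<le> bin_count J u (i - 1) j" by (simp add: bin_count_def sum_nonneg)
  then show "0 < kt_density J u i (u i)"
    using i assms(1) unfolding kt_density_bin[OF j] by (intro mult_pos_pos divide_pos_pos) auto
qed

text \<open>Each point is replaced by the midpoint of its bin, which costs at most half a bin width,
  \<open>1 / (2 * real J)\<close>. The mean of the midpoints depends on the empirical frequencies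
  alone, and their divergence from uniform is limited by the regret bound.\<close>

lemma kt_process_le_imp_mean_deviation:
  assumes "2 \<le> J" "1 \<le> N" and u: "\<And>i. i \<in> {1..N} \<Longrightarrow> u i \<in> {0..1}"
    and C: "kt_regret_constant J C" and b: "kt_process J u N \<le> b"
  shows "\<bar>(\<Sum>i = 1..N. u i) / real N - 1 / 2\<bar> \<le> 1 / (2 * real J) +
    sqrt (max 0 (ln b + (real J - 1) / 2 * ln (real N + 1) + C) / (2 * real N))"
proof -
  define L where "L = ln b + (real J - 1) / 2 * ln (real N + 1) + C"
  define q where "q = emp_freq J u N"
  define h where "h j = (2 * real j - 1) / (2 * real J)" for j
  have "ln (kt_process J u N) \<le> ln b"
    using kt_process_pos[of J N u, OF assms(1) u] b by simp
  moreover have "ln (kt_process J u N) \<ge> real N * kl_unif J q - (real J - 1) / 2 * ln (real N + 1) - C"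
    using C \<open>1 \<le> N\<close> u unfolding kt_regret_constant_def q_def by blast
  ultimately have "real N * kl_unif J q \<le> max 0 L" by (simp add: L_def)
  then have kl: "kl_unif J q / 2 \<le> max 0 L / (2 * real N)"
    using \<open>1 \<le> N\<close> by (simp add: field_simps)
  have bin_ex: "\<exists>j\<in>{1..J}. u i \<in> bin J j" if "i \<in> {1..N}" for i
  proof -
    have "u i \<in> (\<Union>j\<in>{1..J}. bin J j)"
      using u[OF that] assms(1) by (subst Un_bin) auto
    then show ?thesis by blast
  qed
  have "(\<Sum>j = 1..J. q j) = (\<Sum>i = 1..N. \<Sum>j = 1..J. indicator (bin J j) (u i) * 1) / real N"
    using sum_emp_freq[of J u N "\<lambda>_. 1"] by (simp add: q_def)
  also have "(\<Sum>i = 1..N. \<Sum>j = 1..J. indicator (bin J j) (u i) * 1) = (\<Sum>i = 1..N. 1 :: real)"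
  proof (rule sum.cong[OF refl])
    fix i assume "i \<in> {1..N}"
    then obtain j where j: "j \<in> {1..J}" "u i \<in> bin J j" using bin_ex by blast
    show "(\<Sum>j = 1..J. indicator (bin J j) (u i) * 1) = (1 :: real)"
      by (rule sum_indicator_bin[OF j])
  qed
  finally have q1: "(\<Sum>j = 1..J. q j) = 1" using \<open>1 \<le> N\<close> by simp
  \<comment> \<open>The sum of the first \<open>J\<close> odd numbers: the midpoints
    \<open>h j\<close> average to 1/2 under the uniform weights.\<close>
  have "(\<Sum>j = 1..J. 2 * real j - 1) = (real J)\<^sup>2"
    by (induction J) (auto simp: power2_eq_square algebra_simps)
  then have mean_h: "(\<Sum>j = 1..J. h j) / real J = 1 / 2"
    using assms(1) unfolding h_def by (simp add: power2_eq_square flip: sum_divide_distrib)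
  have "((\<Sum>j = 1..J. q j * h j) - (\<Sum>j = 1..J. h j) / real J)\<^sup>2 \<le> kl_unif J q / 2"
  proof (rule kl_unif_mean_deviation)
    show "0 \<le> q j" for j by (simp add: q_def emp_freq_def bin_count_def sum_nonneg)
    show "h j \<in> {0..1}" if "j \<in> {1..J}" for j using that by (auto simp: h_def)
  qed (use assms(1) q1 in auto)
  then have "((\<Sum>j = 1..J. q j * h j) - 1 / 2)\<^sup>2 \<le> kl_unif J q / 2"
    unfolding mean_h .
  also note kl
  finally have 1: "\<bar>(\<Sum>j = 1..J. q j * h j) - 1 / 2\<bar> \<le> sqrt (max 0 L / (2 * real N))"
    by (metis real_sqrt_abs real_sqrt_le_iff)
  have each: "\<bar>u i - (\<Sum>j = 1..J. indicator (bin J j) (u i) * h j)\<bar> \<le> 1 / (2 * real J)"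
    if i: "i \<in> {1..N}" for i
  proof -
    obtain j where j: "j \<in> {1..J}" "u i \<in> bin J j" using bin_ex[OF i] by auto
    then have "(real j - 1) / real J \<le> u i" "u i \<le> real j / real J"
      using assms(1) by (auto simp: bin_def split: if_splits)
    then show ?thesis
      unfolding sum_indicator_bin[OF j] h_def using assms(1) by (simp add: abs_le_iff field_simps)
  qed
  have "(\<Sum>i = 1..N. u i) / real N - (\<Sum>j = 1..J. q j * h j) =
      (\<Sum>i = 1..N. u i - (\<Sum>j = 1..J. indicator (bin J j) (u i) * h j)) / real N"
    unfolding q_def sum_emp_freq by (simp add: sum_subtractf diff_divide_distrib)
  also have "\<bar>\<dots>\<bar> \<le> (\<Sum>i = 1..N. 1 / (2 * real J)) / real N"
    unfolding abs_divide abs_of_nat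
    by (intro divide_right_mono order_trans[OF sum_abs] sum_mono each) auto
  also have "\<dots> = 1 / (2 * real J)" using \<open>1 \<le> N\<close> by simp
  finally show ?thesis using 1 unfolding L_def by linarith
qed

section \<open>Bounded differences of the sum of p-values\<close>

text \<open>Passing from \<open>N\<close> to \<open>Suc N\<close> adds
  \<open>1 / real (Suc N)\<close> to each of the \<open>N\<close> old terms and contributes a new
  term 1, hence at most 2 altogether.\<close>

lemma sum_harmonic_tails:
  "(\<Sum>i = 1..N. 1 + (\<Sum>t = Suc i..N. 1 / real t)) \<le> 2 * real N"
proof (induction N)
  case (Suc N)
  have "(\<Sum>i = 1..Suc N. 1 + (\<Sum>t = Suc i..Suc N. 1 / real t)) =
      (\<Sum>i = 1..N. 1 + (\<Sum>t = Suc i..N. 1 / real t) + 1 / real (Suc N)) + 1"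
    by (simp add: add.assoc)
  also have "\<dots> = (\<Sum>i = 1..N. 1 + (\<Sum>t = Suc i..N. 1 / real t)) + real N / real (Suc N) + 1"
    by (simp only: sum.distrib sum_constant) simp
  also have "\<dots> \<le> 2 * real (Suc N)" 
  proof -
    have "real N / real (Suc N) \<le> 1" by simp
    from add_right_mono[OF add_mono[OF Suc.IH this]] show ?thesis
      by (rule order_trans) simp
  qed
  finally show ?case .
qed simp

text \<open>With \<open>e = 1 / real (Suc N)\<close>, every old term grows by \<open>e\<close>. The
  linear bound above controls the cross term by \<open>4 * real N * e\<close>. Since
  \<open>real N * e = 1 - e\<close>, the total increase is at most
  \<open>5 - 3 * e - e * e\<close>.\<close>

lemma sum_harmonic_tails_squared:
  "(\<Sum>i = 1..N. (1 + (\<Sum>t = Suc i..N. 1 / real t))\<^sup>2) \<le> 5 * real N"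
proof (induction N)
  case (Suc N)
  define a where "a i = 1 + (\<Sum>t = Suc i..N. 1 / real t)" for i
  define e where "e = 1 / real (Suc N)"
  have "(\<Sum>i = 1..Suc N. (1 + (\<Sum>t = Suc i..Suc N. 1 / real t))\<^sup>2) = (\<Sum>i = 1..N. (a i + e)\<^sup>2) + 1"
    by (simp add: a_def e_def add.assoc)
  also have "(\<Sum>i = 1..N. (a i + e)\<^sup>2) = (\<Sum>i = 1..N. (a i)\<^sup>2) + 2 * e * (\<Sum>i = 1..N. a i) + real N * e\<^sup>2"
    by (simp add: power2_sum sum.distrib sum_distrib_left mult_ac)
  also have "(\<Sum>i = 1..N. (a i)\<^sup>2) + 2 * e * (\<Sum>i = 1..N. a i) + real N * e\<^sup>2 + 1 \<le>
      5 * real N + 2 * e * (2 * real N) + real N * e\<^sup>2 + 1"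
    using Suc.IH sum_harmonic_tails[of N] unfolding a_def[symmetric]
    by (intro add_mono mult_left_mono) (auto simp: e_def)
  also have "\<dots> = 5 * real N + 4 * (real N * e) + (real N * e) * e + 1"
    by (simp add: power2_eq_square)
  also have "real N * e = 1 - e" by (simp add: e_def field_simps)
  also have "5 * real N + 4 * (1 - e) + (1 - e) * e + 1 = 5 * real (Suc N) - 3 * e - e * e"
    by (simp add: algebra_simps)
  also have "\<dots> \<le> 5 * real (Suc N)"
  proof -
    have "0 \<le> e" by (simp add: e_def)
    then have "0 \<le> 3 * e + e * e" by simp
    then show ?thesis by simp
  qed
  finally show ?case .
qed simp

section \<open>The sum of p-values as a function of the independent inputs\<close>

lemma pval_in_unit:
  assumes "1 \<le> t" "U t \<omega> \<in> {0..1}"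
  shows "pval X U t \<omega> \<in> {0..1}"
proof -
  have "(\<Sum>r = 1..<t. of_bool (X r \<omega> > X t \<omega>)) \<le> (\<Sum>r = 1..<t. 1 :: real)"
    by (intro sum_mono) simp
  moreover have "0 \<le> (\<Sum>r = 1..<t. of_bool (X r \<omega> > X t \<omega>) :: real)"
    by (intro sum_nonneg) simp
  ultimately show ?thesis using assms by (auto simp: pval_def field_simps of_nat_diff)
qed

text \<open>
  The randomizers are clipped to the unit interval, so that the bounded differences hold everywhere
  and not just almost surely.
\<close>

definition pval_sum :: "nat \<Rightarrow> (nat + nat \<Rightarrow> real) \<Rightarrow> real" where
  "pval_sum N z = (\<Sum>t = 1..N. pval (\<lambda>t z. z (Inl t)) (\<lambda>t z. max 0 (min 1 (z (Inr t)))) t z)"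

text \<open>Coordinates beyond \<open>N\<close> do not enter, so nothing is lost when the inputs are
  restricted to the finite index set of the product space.\<close>

lemma pval_sum_cong:
  assumes "\<And>i. i \<in> {1..N} <+> {1..N} \<Longrightarrow> z i = z' i"
  shows "pval_sum N z = pval_sum N z'"
  unfolding pval_sum_def pval_def
proof (rule sum.cong[OF refl])
  have eq: "z (Inl r) = z' (Inl r)" "z (Inr r) = z' (Inr r)" if "r \<in> {1..N}" for r
    using that assms by (blast intro: InlI InrI)+
  fix t assume t: "t \<in> {1..N}"
  have "(\<Sum>r = 1..<t. of_bool (z (Inl r) > z (Inl t))) =
      (\<Sum>r = 1..<t. of_bool (z' (Inl r) > z' (Inl t)) :: real)"
    using t by (intro sum.cong refl) (simp add: eq)
  then show "((\<Sum>r = 1..<t. of_bool (z (Inl r) > z (Inl t))) + max 0 (min 1 (z (Inr t)))) / real t =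
      ((\<Sum>r = 1..<t. of_bool (z' (Inl r) > z' (Inl t))) + max 0 (min 1 (z' (Inr t)))) / real t"
    by (simp only: eq[OF t])
qed

lemma pval_sum_bounds: "0 \<le> pval_sum N z" "pval_sum N z \<le> real N"
proof -
  have *: "pval (\<lambda>t z. z (Inl t)) (\<lambda>t z. max 0 (min 1 (z (Inr t)))) t z \<in> {0..1}" if "t \<in> {1..N}" for t
    using that by (intro pval_in_unit) auto
  show "0 \<le> pval_sum N z" unfolding pval_sum_def using * by (intro sum_nonneg) auto
  have "pval_sum N z \<le> (\<Sum>t = 1..N. 1)" unfolding pval_sum_def using * by (intro sum_mono) auto
  then show "pval_sum N z \<le> real N" by simp
qed

lemma measurable_pval_sum:
  "pval_sum N \<in> borel_measurable (PiM ({1..N} <+> {1..N}) (\<lambda>_. borel))"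
proof -
  have comp: "(\<lambda>z. z i) \<in> borel_measurable (PiM ({1..N} <+> {1..N}) (\<lambda>_. borel))"
    if "i \<in> {1..N} <+> {1..N}" for i :: "nat + nat"
    using that by (rule measurable_component_singleton)
  show ?thesis
    unfolding pval_sum_def[abs_def] pval_def of_bool_def
    by (intro borel_measurable_sum borel_measurable_divide borel_measurable_add borel_measurable_const
        borel_measurable_max borel_measurable_min measurable_If borel_measurable_less comp)
      (auto simp del: One_nat_def)
qed

definition pval_sum_osc :: "nat \<Rightarrow> nat + nat \<Rightarrow> real" where
  "pval_sum_osc N i = (case i of Inl i \<Rightarrow> 1 + (\<Sum>t = Suc i..N. 1 / real t) | Inr i \<Rightarrow> 1)"

text \<open>An input with index \<open>k\<close> is absent from all earlier p-values. The p-value at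
  \<open>k\<close> stays in the unit interval and so moves by at most 1. A later p-value at
  \<open>t\<close> contains \<open>X k\<close> in a single comparison of weight
  \<open>1 / real t\<close> and does not contain \<open>U k\<close>.\<close>

lemma pval_sum_bounded_differences:
  assumes i: "i \<in> {1..N} <+> {1..N}"
  shows "\<bar>pval_sum N (z(i := y)) - pval_sum N z\<bar> \<le> pval_sum_osc N i"
proof -
  let ?p = "\<lambda>t z. pval (\<lambda>t z. z (Inl t)) (\<lambda>t z. max 0 (min 1 (z (Inr t)))) t z"
  have unit: "?p t z \<in> {0..1}" if "1 \<le> t" for t z
    using that by (intro pval_in_unit) auto
  define k where "k = (case i of Inl i \<Rightarrow> i | Inr i \<Rightarrow> i)"
  have k: "k \<in> {1..N}" using i by (auto simp: k_def)
  define d where "d t = \<bar>?p t (z(i := y)) - ?p t z\<bar>" for t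
  have "{1..N} = {1..<k} \<union> {k} \<union> {Suc k..N}" using k by auto
  then have split: "(\<Sum>t = 1..N. d t) = (\<Sum>t = 1..<k. d t) + d k + (\<Sum>t = Suc k..N. d t)"
    by (simp only:) (subst sum.union_disjoint; auto)+
  have "(\<Sum>t = 1..<k. d t) = 0"
  proof (intro sum.neutral ballI)
    fix t assume "t \<in> {1..<k}"
    then show "d t = 0"
      by (cases i) (auto simp: d_def k_def pval_def intro!: arg_cong2[where f = "(/)"] sum.cong)
  qed
  moreover have "d k \<le> 1" using unit[of k z] unit[of k "z(i := y)"] k by (auto simp: d_def)
  moreover have "(\<Sum>t = Suc k..N. d t) \<le> pval_sum_osc N i - 1"
  proof (cases i)
    case (Inr i')
    have "d t = 0" if "t \<in> {Suc k..N}" for t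
      using that by (auto simp: Inr d_def k_def pval_def)
    then show ?thesis by (simp add: Inr pval_sum_osc_def)
  next
    case (Inl i')
    have "d t \<le> 1 / real t" if t: "t \<in> {Suc k..N}" for t
    proof -
      have "i' \<in> {1..<t}" "i' \<noteq> t" using t k by (auto simp: k_def Inl)
      have "?p t (z(i := y)) - ?p t z =
          (\<Sum>r = 1..<t. of_bool ((z(i := y)) (Inl r) > z (Inl t)) - of_bool (z (Inl r) > z (Inl t))) / real t"
        using \<open>i' \<noteq> t\<close> by (simp add: pval_def Inl sum_subtractf flip: diff_divide_distrib)
      also have "(\<Sum>r = 1..<t. of_bool ((z(i := y)) (Inl r) > z (Inl t)) - of_bool (z (Inl r) > z (Inl t))) =
          (of_bool (y > z (Inl t)) - of_bool (z (Inl i') > z (Inl t)) :: real)"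
        using \<open>i' \<in> {1..<t}\<close> by (subst sum.remove[of _ i']) (auto simp: Inl intro!: sum.neutral)
      finally have "d t = \<bar>of_bool (y > z (Inl t)) - of_bool (z (Inl i') > z (Inl t))\<bar> / real t"
        by (simp only: d_def abs_divide abs_of_nat)
      also have "\<dots> \<le> 1 / real t"
        by (intro divide_right_mono) auto
      finally show ?thesis .
    qed
    then show ?thesis by (auto simp: Inl k_def pval_sum_osc_def intro!: sum_mono)
  qed
  ultimately have "(\<Sum>t = 1..N. d t) \<le> pval_sum_osc N i" using split by simp
  moreover have "\<bar>pval_sum N (z(i := y)) - pval_sum N z\<bar> \<le> (\<Sum>t = 1..N. d t)"
    unfolding pval_sum_def d_def by (simp only: sum_abs flip: sum_subtractf)
  ultimately show ?thesis by linarith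
qed

text \<open>The observations contribute at most \<open>5 * real N\<close>, the randomizers exactly
  \<open>real N\<close>.\<close>

lemma sum_pval_sum_osc_squared: "(\<Sum>i\<in>{1..N} <+> {1..N}. (pval_sum_osc N i)\<^sup>2) \<le> 6 * real N"
  using sum_harmonic_tails_squared[of N] by (simp add: sum.Plus pval_sum_osc_def)

section \<open>The p-values in the change-point model\<close>

text \<open>Swapping the two coordinates preserves the product measure, so both strict orders are
  equally likely. Continuity of the distribution function excludes atoms, so by Fubini the diagonal
  is a null set.\<close>

lemma exceed_prob_same:
  assumes "real_distribution F" "continuous_on UNIV (cdf F)"
  shows "exceed_prob F F = 1 / 2"
proof -
  interpret F: real_distribution F by fact
  interpret P: pair_prob_space F F ..
  have null: "F.prob {x} = 0" for x
    using assms(2) F.isCont_cdf[of x] by (simp add: continuous_on_eq_continuous_at)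
  have sets_F [measurable_cong]: "sets (F \<Otimes>\<^sub>M F) = sets (borel \<Otimes>\<^sub>M borel)"
    by (intro sets_pair_measure_cong) auto
  have sp: "space (F \<Otimes>\<^sub>M F) = UNIV" by (simp add: space_pair_measure)
  have meas: "{z. P (fst z) (snd z)} \<in> sets (F \<Otimes>\<^sub>M F)"
    if "Measurable.pred (F \<Otimes>\<^sub>M F) (\<lambda>z. P (fst z) (snd z))" for P :: "real \<Rightarrow> real \<Rightarrow> bool"
    using that unfolding pred_def sp by simp
  have gt: "{z. fst z > snd z} \<in> sets (F \<Otimes>\<^sub>M F)" by (rule meas) measurable
  have lt: "{z. fst z < snd z} \<in> sets (F \<Otimes>\<^sub>M F)" by (rule meas) measurable
  have eq: "{z. fst z = snd z} \<in> sets (F \<Otimes>\<^sub>M F)" by (rule meas) measurable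
  have "emeasure (F \<Otimes>\<^sub>M F) {z. fst z = snd z} = (\<integral>\<^sup>+x. emeasure F (Pair x -` {z. fst z = snd z}) \<partial>F)"
    using eq by (rule F.emeasure_pair_measure_alt)
  also have "\<dots> = (\<integral>\<^sup>+x. 0 \<partial>F)"
  proof (rule nn_integral_cong)
    fix x :: real
    have "Pair x -` {z. fst z = snd z} = {x}" by auto
    then show "emeasure F (Pair x -` {z. fst z = snd z}) = 0"
      using null[of x] by (simp add: F.emeasure_eq_measure)
  qed
  finally have diag: "measure (F \<Otimes>\<^sub>M F) {z. fst z = snd z} = 0" by (simp add: measure_def)
  have "measure (F \<Otimes>\<^sub>M F) {z. fst z > snd z} =
      measure (distr (F \<Otimes>\<^sub>M F) (F \<Otimes>\<^sub>M F) (\<lambda>(x, y). (y, x))) {z. fst z > snd z}"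
    by (subst P.distr_pair_swap) simp
  also have "\<dots> = measure (F \<Otimes>\<^sub>M F) {z. fst z < snd z}"
    using gt by (subst measure_distr) (auto simp: sp intro!: arg_cong[where f = "measure (F \<Otimes>\<^sub>M F)"])
  finally have swap: "measure (F \<Otimes>\<^sub>M F) {z. fst z > snd z} = measure (F \<Otimes>\<^sub>M F) {z. fst z < snd z}" .
  have univ: "({z. fst z > snd z} \<union> {z. fst z < snd z}) \<union> {z. fst z = snd z} = space (F \<Otimes>\<^sub>M F)"
    by (auto simp: sp)
  have "1 = measure (F \<Otimes>\<^sub>M F) (({z. fst z > snd z} \<union> {z. fst z < snd z}) \<union> {z. fst z = snd z})"
    unfolding univ by (simp add: P.prob_space)
  also have "\<dots> = measure (F \<Otimes>\<^sub>M F) ({z. fst z > snd z} \<union> {z. fst z < snd z}) + measure (F \<Otimes>\<^sub>M F) {z. fst z = snd z}"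
    using gt lt eq by (intro P.finite_measure_Union sets.Un) auto
  also have "measure (F \<Otimes>\<^sub>M F) ({z. fst z > snd z} \<union> {z. fst z < snd z}) =
      measure (F \<Otimes>\<^sub>M F) {z. fst z > snd z} + measure (F \<Otimes>\<^sub>M F) {z. fst z < snd z}"
    using gt lt by (intro P.finite_measure_Union) auto
  finally show ?thesis unfolding exceed_prob_def using swap diag by simp
qed

context change_point_model
begin

lemma random_variable_X [measurable]: "1 \<le> t \<Longrightarrow> random_variable borel (X t)"
  and random_variable_U [measurable]: "1 \<le> t \<Longrightarrow> random_variable borel (U t)"
proof -
  have rv: "random_variable borel (case_sum X U i)" if "i \<in> {1..} <+> {1..}" for i
    using indep that by (auto simp: indep_vars_def)
  show "random_variable borel (X t)" if "1 \<le> t" using rv[of "Inl t"] that by auto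
  show "random_variable borel (U t)" if "1 \<le> t" using rv[of "Inr t"] that by auto
qed

lemma AE_U_in_unit:
  assumes "1 \<le> t"
  shows "AE \<omega> in M. U t \<omega> \<in> {0..1}"
proof -
  have "AE x in uniform_measure lborel {0<..<1 :: real}. x \<in> {0..1}"
    by (rule AE_uniform_measureI) auto
  then have "AE x in distr M borel (U t). x \<in> {0..1}"
    by (simp only: distr_unif[OF assms])
  then show ?thesis by (rule AE_distrD[rotated]) (use assms in measurable)
qed

lemma expectation_U:
  assumes "1 \<le> t"
  shows "expectation (U t) = 1 / 2"
proof -
  \<comment> \<open>The formula for the mean of a uniform variable is applied on the closed
    interval. The densities for the open and the closed interval differ only at 0 and 1.\<close>
  have "distributed M lborel (U t) (\<lambda>x. indicator {0..1 :: real} x / measure lborel {0..1 :: real})"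
    unfolding distributed_def
  proof (intro conjI)
    have "distr M lborel (U t) = distr M borel (U t)" by (rule distr_cong) auto
    also have "\<dots> = uniform_measure lborel {0<..<1}" by (rule distr_unif[OF assms])
    also have "\<dots> = density lborel (\<lambda>x. ennreal (indicator {0..1 :: real} x / measure lborel {0..1 :: real}))"
      unfolding uniform_measure_def
    proof (rule density_cong)
      have "AE x in lborel. x \<noteq> (0 :: real)" "AE x in lborel. x \<noteq> (1 :: real)"
        by (rule AE_lborel_singleton)+
      then show "AE x in lborel. indicator {0<..<1 :: real} x / emeasure lborel {0<..<1 :: real} =
          ennreal (indicator {0..1} x / measure lborel {0..1 :: real})"
        by eventually_elim (auto simp: indicator_def)
    qed auto
    finally show "distr M lborel (U t) =
        density lborel (\<lambda>x. ennreal (indicator {0..1 :: real} x / measure lborel {0..1 :: real}))" .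
  qed (use assms in auto)
  from uniform_distributed_expectation[OF this] show ?thesis by simp
qed

lemma expectation_exceed:
  assumes "1 \<le> r" "1 \<le> t" "r \<noteq> t"
  shows "expectation (\<lambda>\<omega>. of_bool (X r \<omega> > X t \<omega>)) = exceed_prob (distr M borel (X r)) (distr M borel (X t))"
proof -
  have [measurable]: "random_variable borel (X r)" "random_variable borel (X t)" using assms by auto
  \<comment> \<open>Mutual independence is specialised to the singleton blocks
    \<open>{Inl r}\<close> and \<open>{Inl t}\<close>, each then evaluated at its only
    coordinate.\<close>
  have "indep_var borel ((\<lambda>z. z (Inl r)) \<circ> (\<lambda>\<omega>. restrict (\<lambda>i. case_sum X U i \<omega>) {Inl r}))
     borel ((\<lambda>z. z (Inl t)) \<circ> (\<lambda>\<omega>. restrict (\<lambda>i. case_sum X U i \<omega>) {Inl t}))"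
    using assms by (intro indep_var_compose[OF indep_var_restrict[OF indep]]) auto
  also have "(\<lambda>z. z (Inl r)) \<circ> (\<lambda>\<omega>. restrict (\<lambda>i. case_sum X U i \<omega>) {Inl r}) = X r"
    by auto
  also have "(\<lambda>z. z (Inl t)) \<circ> (\<lambda>\<omega>. restrict (\<lambda>i. case_sum X U i \<omega>) {Inl t}) = X t"
    by auto
  finally have joint: "distr M borel (X r) \<Otimes>\<^sub>M distr M borel (X t) =
      distr M (borel \<Otimes>\<^sub>M borel) (\<lambda>\<omega>. (X r \<omega>, X t \<omega>))"
    by (simp add: indep_var_distribution_eq)
  have "{z :: real \<times> real. fst z > snd z} = {z \<in> space (borel \<Otimes>\<^sub>M borel). fst z > snd z}"
    by (simp add: space_pair_measure)
  also have "\<dots> \<in> sets (borel \<Otimes>\<^sub>M borel)" by measurable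
  finally have [measurable]: "{z :: real \<times> real. fst z > snd z} \<in> sets (borel \<Otimes>\<^sub>M borel)" .
  have "exceed_prob (distr M borel (X r)) (distr M borel (X t)) =
      prob ((\<lambda>\<omega>. (X r \<omega>, X t \<omega>)) -` {z. fst z > snd z} \<inter> space M)"
    unfolding exceed_prob_def joint by (rule measure_distr) measurable
  also have "(\<lambda>\<omega>. (X r \<omega>, X t \<omega>)) -` {z. fst z > snd z} \<inter> space M = {\<omega> \<in> space M. X r \<omega> > X t \<omega>}"
    by auto
  also have "prob \<dots> = expectation (indicator {\<omega> \<in> space M. X r \<omega> > X t \<omega>})"
    by simp
  also have "\<dots> = expectation (\<lambda>\<omega>. of_bool (X r \<omega> > X t \<omega>))"
    by (intro Bochner_Integration.integral_cong) (auto simp: indicator_def)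
  finally show ?thesis ..
qed

lemma expectation_pval:
  assumes "1 \<le> t"
  shows "expectation (pval X U t) =
    ((\<Sum>r = 1..<t. exceed_prob (distr M borel (X r)) (distr M borel (X t))) + 1 / 2) / real t"
    and "integrable M (pval X U t)"
proof -
  have [measurable]: "random_variable borel (X t)" using assms by auto
  have int_U: "integrable M (U t)"
    by (rule integrable_const_bound[where B = 1])
      (use AE_U_in_unit[OF assms] assms in auto)
  have int_X: "integrable M (\<lambda>\<omega>. of_bool (X r \<omega> > X t \<omega>) :: real)" if "r \<in> {1..<t}" for r
  proof -
    have [measurable]: "random_variable borel (X r)" using that by auto
    show ?thesis by (rule integrable_const_bound[where B = 1]) auto
  qed
  show "integrable M (pval X U t)"
    unfolding pval_def by (intro integrable_divide_zero Bochner_Integration.integrable_add Bochner_Integration.integrable_sum int_U int_X)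
  have "expectation (pval X U t) =
      ((\<Sum>r = 1..<t. expectation (\<lambda>\<omega>. of_bool (X r \<omega> > X t \<omega>))) + expectation (U t)) / real t"
    unfolding pval_def integral_divide_zero
    by (subst Bochner_Integration.integral_add)
      (auto simp only: Bochner_Integration.integral_sum[OF int_X] intro!: int_U int_X Bochner_Integration.integrable_sum)
  also have "(\<Sum>r = 1..<t. expectation (\<lambda>\<omega>. of_bool (X r \<omega> > X t \<omega>) :: real)) =
      (\<Sum>r = 1..<t. exceed_prob (distr M borel (X r)) (distr M borel (X t)))"
    using assms by (intro sum.cong expectation_exceed) auto
  finally show "expectation (pval X U t) =
      ((\<Sum>r = 1..<t. exceed_prob (distr M borel (X r)) (distr M borel (X t))) + 1 / 2) / real t"
    using expectation_U[OF assms] by simp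
qed

end

section \<open>From a missing alarm to the delay bound\<close>

lemma kt_alarm_gt_imp_process_le:
  assumes "enat N < kt_alarm J B u" "1 \<le> t" "t \<le> N"
  shows "kt_process J u t \<le> B t"
proof (rule ccontr)
  assume "\<not> kt_process J u t \<le> B t"
  then have "kt_alarm J B u \<le> enat t"
    unfolding kt_alarm_def using assms(2) by (intro INF_lower) auto
  then have "enat N < enat t" using assms(1) by (rule less_le_trans[rotated])
  then show False using assms(3) by simp
qed

context change_point_model
begin

text \<open>Comparisons within one sample succeed with probability 1/2, which gives every pre-change
  p-value the mean 1/2. At time \<open>\<tau> + k\<close> there are \<tau> comparisons across the
  change with probability \<theta> and \<open>k - 1\<close> with probability 1/2, so the mean is
  shifted by \<open>(\<theta> - 1 / 2) * (real \<tau> / (real \<tau> + real k))\<close>.\<close>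

lemma expectation_sum_pval:
  assumes "1 \<le> \<tau>" and cont: "continuous_on UNIV (cdf F0)" "continuous_on UNIV (cdf F1)"
  shows "expectation (\<lambda>\<omega>. \<Sum>t = 1..\<tau> + m. pval X U t \<omega>) =
    real (\<tau> + m) * (1 / 2 + (exceed_prob F0 F1 - 1 / 2) * delay_weight \<tau> m)"
proof -
  define \<theta> where "\<theta> = exceed_prob F0 F1"
  have half: "exceed_prob F0 F0 = 1 / 2" "exceed_prob F1 F1 = 1 / 2"
    using exceed_prob_same[OF F0.real_distribution_axioms cont(1)]
      exceed_prob_same[OF F1.real_distribution_axioms cont(2)] by auto
  have pre: "expectation (pval X U t) = 1 / 2" if t: "t \<in> {1..\<tau>}" for t
  proof -
    have "(\<Sum>r = 1..<t. exceed_prob (distr M borel (X r)) (distr M borel (X t))) = (\<Sum>r = 1..<t. 1 / 2)"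
      using t by (intro sum.cong refl) (simp add: distr_pre half)
    then show ?thesis
      using t expectation_pval(1)[of t] by (simp add: field_simps of_nat_diff)
  qed
  have post: "expectation (pval X U (\<tau> + k)) = 1 / 2 + (\<theta> - 1 / 2) * (real \<tau> / (real \<tau> + real k))"
    if k: "k \<in> {1..m}" for k
  proof -
    have ivl: "{1..<\<tau> + k} = {1..\<tau>} \<union> {\<tau><..<\<tau> + k}" using k assms(1) by auto
    have "(\<Sum>r = 1..<\<tau> + k. exceed_prob (distr M borel (X r)) (distr M borel (X (\<tau> + k)))) =
        (\<Sum>r = 1..<\<tau> + k. if r \<le> \<tau> then \<theta> else 1 / 2)"
      using k by (intro sum.cong refl) (simp add: distr_pre distr_post half \<theta>_def)
    also have "\<dots> = (\<Sum>r = 1..\<tau>. \<theta>) + (\<Sum>r\<in>{\<tau><..<\<tau> + k}. 1 / 2)"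
      unfolding ivl by (subst sum.union_disjoint) (auto intro!: arg_cong2[where f = "(+)"] sum.cong)
    also have "\<dots> = real \<tau> * \<theta> + (real k - 1) / 2"
      using k by (simp add: of_nat_diff)
    finally have "expectation (pval X U (\<tau> + k)) = (real \<tau> * \<theta> + (real k - 1) / 2 + 1 / 2) / (real \<tau> + real k)"
      using k expectation_pval(1)[of "\<tau> + k"] by simp
    also have "\<dots> = 1 / 2 + (\<theta> - 1 / 2) * (real \<tau> / (real \<tau> + real k))"
    proof -
      have "real \<tau> + real k \<noteq> 0" using k by simp
      then show ?thesis by (simp add: divide_simps) (simp add: algebra_simps)
    qed
    finally show ?thesis .
  qed
  have "expectation (\<lambda>\<omega>. \<Sum>t = 1..\<tau> + m. pval X U t \<omega>) = (\<Sum>t = 1..\<tau> + m. expectation (pval X U t))"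
    by (intro Bochner_Integration.integral_sum expectation_pval(2)) auto
  also have "\<dots> = (\<Sum>t = 1..\<tau>. expectation (pval X U t)) + (\<Sum>t = \<tau> + 1..\<tau> + m. expectation (pval X U t))"
    by (rule sum.ub_add_nat) simp
  also have "(\<Sum>t = \<tau> + 1..\<tau> + m. expectation (pval X U t)) = (\<Sum>k = 1..m. expectation (pval X U (\<tau> + k)))"
    using sum.shift_bounds_cl_nat_ivl[of "\<lambda>t. expectation (pval X U t)" 1 \<tau> m] by (simp add: add.commute)
  also have "\<dots> = (\<Sum>k = 1..m. 1 / 2 + (\<theta> - 1 / 2) * (real \<tau> / (real \<tau> + real k)))"
    by (intro sum.cong refl post)
  also have "\<dots> = real m / 2 + (\<theta> - 1 / 2) * (\<Sum>k = 1..m. real \<tau> / (real \<tau> + real k))"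
    by (simp add: sum.distrib sum_distrib_left)
  also have "(\<Sum>k = 1..m. real \<tau> / (real \<tau> + real k)) = real (\<tau> + m) * delay_weight \<tau> m"
    using assms(1) by (simp add: delay_weight_def)
  also have "(\<Sum>t = 1..\<tau>. expectation (pval X U t)) = (\<Sum>t = 1..\<tau>. 1 / 2)"
    by (intro sum.cong refl pre)
  finally show ?thesis unfolding \<theta>_def by (simp add: algebra_simps add_divide_distrib)
qed

text \<open>Almost surely the randomizers lie in the unit interval, where clipping is the identity.
  This carries results for \<open>pval_sum\<close> over to the p-values of the model.\<close>

lemma AE_pval_sum:
  "AE \<omega> in M. (\<forall>t\<in>{1..N}. pval X U t \<omega> \<in> {0..1}) \<and>
    pval_sum N (\<lambda>i\<in>{1..N} <+> {1..N}. case_sum X U i \<omega>) = (\<Sum>t = 1..N. pval X U t \<omega>)"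
proof -
  have "AE \<omega> in M. \<forall>t\<in>{1..N}. U t \<omega> \<in> {0..1}"
    by (intro AE_finite_allI AE_U_in_unit) auto
  then show ?thesis
  proof (eventually_elim, intro conjI ballI)
    fix \<omega> assume U: "\<forall>t\<in>{1..N}. U t \<omega> \<in> {0..1}"
    show "pval X U t \<omega> \<in> {0..1}" if "t \<in> {1..N}" for t
      using U that by (intro pval_in_unit) auto
    have "pval_sum N (\<lambda>i\<in>{1..N} <+> {1..N}. case_sum X U i \<omega>) = pval_sum N (\<lambda>i. case_sum X U i \<omega>)"
      by (rule pval_sum_cong) simp
    also have "\<dots> = (\<Sum>t = 1..N. pval X U t \<omega>)"
      unfolding pval_sum_def
    proof (rule sum.cong[OF refl])
      fix t assume "t \<in> {1..N}"
      then have "max 0 (min 1 (U t \<omega>)) = U t \<omega>" using U by force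
      then show "pval (\<lambda>t z. z (Inl t)) (\<lambda>t z. max 0 (min 1 (z (Inr t)))) t (\<lambda>i. case_sum X U i \<omega>) = pval X U t \<omega>"
        by (simp add: pval_def)
    qed
    finally show "pval_sum N (\<lambda>i\<in>{1..N} <+> {1..N}. case_sum X U i \<omega>) = (\<Sum>t = 1..N. pval X U t \<omega>)" .
  qed
qed

text \<open>The event \<open>A\<close> is arbitrary because the alarm events are not shown to be measurable.\<close>

lemma sum_pval_deviation:
  assumes "1 \<le> N" "\<bar>s\<bar> = 1" "0 \<le> e"
    and "A \<subseteq> space M" and A: "\<And>\<omega>. \<omega> \<in> A \<Longrightarrow> (\<And>t. t \<in> {1..N} \<Longrightarrow> pval X U t \<omega> \<in> {0..1}) \<Longrightarrow>
      s * (\<Sum>t = 1..N. pval X U t \<omega>) \<ge> s * expectation (\<lambda>\<omega>. \<Sum>t = 1..N. pval X U t \<omega>) + real N * e"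
  shows "prob A \<le> exp (- (2 * real N / 7) * e\<^sup>2)"
proof -
  define I where "I = {1..N} <+> {1..N}"
  define Z where "Z \<omega> = (\<lambda>i\<in>I. case_sum X U i \<omega>)" for \<omega>
  \<comment> \<open>The sign \<open>s\<close> turns either tail into an upper tail and leaves the
    size and difference bounds unchanged.\<close>
  define f where "f z = s * pval_sum N z" for z
  have ind: "indep_vars (\<lambda>_. borel) (case_sum X U) I"
    by (rule indep_vars_subset[OF indep]) (auto simp: I_def)
  have f: "f \<in> borel_measurable (PiM I (\<lambda>_. borel))"
    unfolding f_def[abs_def] I_def by (intro borel_measurable_times measurable_pval_sum borel_measurable_const)
  have "(\<lambda>\<omega>. \<lambda>i\<in>I. case_sum X U i \<omega>) \<in> M \<rightarrow>\<^sub>M PiM I (\<lambda>_. borel)"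
    using ind by (intro measurable_restrict) (auto simp: indep_vars_def)
  then have fZ [measurable]: "random_variable borel (\<lambda>\<omega>. f (Z \<omega>))"
    unfolding Z_def by (rule measurable_compose) (rule f)
  have AE: "AE \<omega> in M. (\<forall>t\<in>{1..N}. pval X U t \<omega> \<in> {0..1}) \<and> f (Z \<omega>) = s * (\<Sum>t = 1..N. pval X U t \<omega>)"
    using AE_pval_sum[of N] unfolding f_def Z_def I_def by eventually_elim metis
  have meas_pval: "random_variable borel (\<lambda>\<omega>. \<Sum>t = 1..N. pval X U t \<omega>)"
    by (intro borel_measurable_sum borel_measurable_integrable expectation_pval(2)) auto
  have "expectation (\<lambda>\<omega>. f (Z \<omega>)) = expectation (\<lambda>\<omega>. s * (\<Sum>t = 1..N. pval X U t \<omega>))"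
    using AE meas_pval by (intro integral_cong_AE) auto
  then have mean: "expectation (\<lambda>\<omega>. f (Z \<omega>)) = s * expectation (\<lambda>\<omega>. \<Sum>t = 1..N. pval X U t \<omega>)"
    by simp
  have "prob A \<le> prob {\<omega> \<in> space M. f (Z \<omega>) \<ge> expectation (\<lambda>\<omega>. f (Z \<omega>)) + real N * e}"
  \<comment> \<open>Only the larger event has to be measurable; a non-measurable \<open>A\<close>
    would have measure 0 by default.\<close>
  proof (rule finite_measure_mono_AE)
    show "AE \<omega> in M. \<omega> \<in> A \<longrightarrow> \<omega> \<in> {\<omega> \<in> space M. f (Z \<omega>) \<ge> expectation (\<lambda>\<omega>. f (Z \<omega>)) + real N * e}"
      using AE
    proof (eventually_elim, intro impI CollectI conjI)
      fix \<omega> assume \<omega>: "(\<forall>t\<in>{1..N}. pval X U t \<omega> \<in> {0..1}) \<and> f (Z \<omega>) = s * (\<Sum>t = 1..N. pval X U t \<omega>)"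
        and "\<omega> \<in> A"
      show "\<omega> \<in> space M" using \<open>\<omega> \<in> A\<close> assms(4) by blast
      show "f (Z \<omega>) \<ge> expectation (\<lambda>\<omega>. f (Z \<omega>)) + real N * e"
        using A[OF \<open>\<omega> \<in> A\<close>] \<omega> unfolding mean by metis
    qed
  qed measurable
  also have "\<dots> \<le> exp (- 2 * (real N * e)\<^sup>2 / (7 * real N))"
    unfolding Z_def
  proof (rule McDiarmid_inequality[where K = "real N" and c = "pval_sum_osc N", OF _ _ ind f])
    show "finite I" by (simp add: I_def)
    show "I \<noteq> {}" using \<open>1 \<le> N\<close> by (auto simp: I_def)
    show "\<bar>f z\<bar> \<le> real N" for z
      using pval_sum_bounds[of N z] \<open>\<bar>s\<bar> = 1\<close> by (simp add: f_def abs_mult)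
    show "\<bar>f (z(i := y)) - f z\<bar> \<le> pval_sum_osc N i" if "i \<in> I" for i z y
      using pval_sum_bounded_differences[of i N z y] that \<open>\<bar>s\<bar> = 1\<close>
      unfolding f_def I_def by (simp only: abs_mult flip: right_diff_distrib) simp
    \<comment> \<open>The sum is at most \<open>6 * real N\<close>; the constant 7 of the stated
      exponent leaves some slack.\<close>
    show "(\<Sum>i\<in>I. (pval_sum_osc N i)\<^sup>2) \<le> 7 * real N"
      using sum_pval_sum_osc_squared[of N] unfolding I_def by linarith
  qed (use assms in auto)
  also have "- 2 * (real N * e)\<^sup>2 / (7 * real N) = - (2 * real N / 7) * e\<^sup>2"
    using \<open>1 \<le> N\<close> by (simp add: power2_eq_square)
  finally show ?thesis .
qed

text \<open>
  The bound at \<open>m\<close> is stated for the later time \<open>\<tau> + n\<close>, since deducing it from \<open>n = m\<close> by monotonicity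
  would require the alarm event at \<open>\<tau> + m\<close> to be measurable.
\<close>

lemma late_alarm_bound:
  assumes "1 \<le> \<tau>" "2 \<le> J" "1 \<le> m" "m \<le> n"
    and cont: "continuous_on UNIV (cdf F0)" "continuous_on UNIV (cdf F1)"
    and \<Delta>: "\<Delta> = \<bar>exceed_prob F0 F1 - 1 / 2\<bar>" "0 < \<Delta>"
    and C: "kt_regret_constant J C"
  shows "prob {\<omega> \<in> space M. kt_alarm J B (\<lambda>t. pval X U t \<omega>) > enat (\<tau> + n)}
    \<le> exp (- (2 * (real \<tau> + real m) / 7) *
        (max 0 (\<Delta> * delay_weight \<tau> m - 1 / (2 * real J)
          - sqrt (max 0 (log_threshold B C \<tau> m J) / (2 * (real \<tau> + real m)))))\<^sup>2)"
proof -
  define N where "N = \<tau> + m"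
  have "1 \<le> N" using \<open>1 \<le> \<tau>\<close> by (simp add: N_def)
  define R where "R = 1 / (2 * real J) + sqrt (max 0 (log_threshold B C \<tau> m J) / (2 * real N))"
  define e where "e = \<Delta> * delay_weight \<tau> m - R"
  \<comment> \<open>The sign points from the expected mean back towards 1/2. Without an alarm,
    \<open>s\<close> times the sum is at least \<open>real N * s / 2 - real N * R\<close>, while its
    expectation is \<open>real N * s / 2 - real N * (\<Delta> * delay_weight \<tau> m)\<close>. The
    gap is \<open>real N * e\<close>.\<close>
  define s where "s = - sgn (exceed_prob F0 F1 - 1 / 2)"
  have s: "\<bar>s\<bar> = 1" "s * (exceed_prob F0 F1 - 1 / 2) = - \<Delta>"
    using \<Delta> by (auto simp: s_def sgn_if abs_if split: if_splits)
  have "prob {\<omega> \<in> space M. kt_alarm J B (\<lambda>t. pval X U t \<omega>) > enat (\<tau> + n)}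
      \<le> exp (- (2 * real N / 7) * (max 0 e)\<^sup>2)"
  proof (cases "0 \<le> e")
    \<comment> \<open>The truncation makes the exponent 0, and the bound becomes 1.\<close>
    case False
    then show ?thesis by simp
  next
    case True
    then have "max 0 e = e" by simp
    show ?thesis unfolding \<open>max 0 e = e\<close>
    proof (rule sum_pval_deviation[OF \<open>1 \<le> N\<close> s(1) True])
      fix \<omega> assume "\<omega> \<in> {\<omega> \<in> space M. kt_alarm J B (\<lambda>t. pval X U t \<omega>) > enat (\<tau> + n)}"
      then have "kt_process J (\<lambda>t. pval X U t \<omega>) N \<le> B N"
        using \<open>1 \<le> N\<close> \<open>m \<le> n\<close> by (intro kt_alarm_gt_imp_process_le[of "\<tau> + n"]) (auto simp: N_def)
      moreover assume unit: "\<And>t. t \<in> {1..N} \<Longrightarrow> pval X U t \<omega> \<in> {0..1}"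
      ultimately have "\<bar>(\<Sum>t = 1..N. pval X U t \<omega>) / real N - 1 / 2\<bar> \<le> 1 / (2 * real J) +
          sqrt (max 0 (ln (B N) + (real J - 1) / 2 * ln (real N + 1) + C) / (2 * real N))"
        by (intro kt_process_le_imp_mean_deviation \<open>2 \<le> J\<close> \<open>1 \<le> N\<close> C) auto
      also have "\<dots> = R" by (simp add: R_def log_threshold_def N_def)
      finally have "\<bar>s * ((\<Sum>t = 1..N. pval X U t \<omega>) / real N - 1 / 2)\<bar> \<le> R"
        using s(1) by (simp only: abs_mult mult_1_left)
      then have "- R \<le> s * ((\<Sum>t = 1..N. pval X U t \<omega>) / real N - 1 / 2)"
        unfolding abs_le_iff by simp
      then have "real N * (- R) \<le> real N * (s * ((\<Sum>t = 1..N. pval X U t \<omega>) / real N - 1 / 2))"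
        by (rule mult_left_mono) simp
      also have "\<dots> = s * (\<Sum>t = 1..N. pval X U t \<omega>) - real N * s / 2"
        using \<open>1 \<le> N\<close> by (simp add: field_simps)
      finally have "s * (\<Sum>t = 1..N. pval X U t \<omega>) \<ge> real N * s / 2 - real N * R" by simp
      moreover have "s * expectation (\<lambda>\<omega>. \<Sum>t = 1..N. pval X U t \<omega>) + real N * e = real N * s / 2 - real N * R"
      proof -
        have "s * expectation (\<lambda>\<omega>. \<Sum>t = 1..N. pval X U t \<omega>) =
            real N * s / 2 + real N * ((s * (exceed_prob F0 F1 - 1 / 2)) * delay_weight \<tau> m)"
          unfolding N_def expectation_sum_pval[OF \<open>1 \<le> \<tau>\<close> cont] by (simp add: algebra_simps)
        then show ?thesis unfolding s(2) by (simp add: e_def algebra_simps)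
      qed
      ultimately show "s * (\<Sum>t = 1..N. pval X U t \<omega>) \<ge>
          s * expectation (\<lambda>\<omega>. \<Sum>t = 1..N. pval X U t \<omega>) + real N * e" by simp
    qed auto
  qed
  then show ?thesis by (simp add: e_def R_def N_def diff_diff_eq)
qed

end

theorem theorem4p5:
  fixes M :: "'a measure" and \<tau> J :: nat and F0 F1 :: "real measure"
    and X U :: "nat \<Rightarrow> 'a \<Rightarrow> real" and B :: "nat \<Rightarrow> real" and C \<theta> \<Delta> :: real
  assumes "1 \<le> \<tau>" and "2 \<le> J"
    and "change_point_model M \<tau> F0 F1 X U"
    and "continuous_on UNIV (cdf F0)" and "continuous_on UNIV (cdf F1)"
    and "\<theta> = exceed_prob F0 F1" and "\<Delta> = \<bar>\<theta> - 1 / 2\<bar>" and "0 < \<Delta>"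
    and "\<And>t. 1 \<le> t \<Longrightarrow> 0 < B t"
    and "kt_regret_constant J C"
  shows "(\<forall>m\<ge>1.
            measure M {\<omega> \<in> space M. kt_alarm J B (\<lambda>t. pval X U t \<omega>) > enat (\<tau> + m)}
              \<le> exp (- (2 * (real \<tau> + real m) / 7) *
                  (max 0 (\<Delta> * delay_weight \<tau> m - 1 / (2 * real J)
                    - sqrt (max 0 (log_threshold B C \<tau> m J) / (2 * (real \<tau> + real m)))))\<^sup>2))
       \<and> (\<forall>n\<ge>1.
            measure M {\<omega> \<in> space M. kt_alarm J B (\<lambda>t. pval X U t \<omega>) > enat (\<tau> + n)}
              \<le> (INF m\<in>{1..n}. exp (- (2 * (real \<tau> + real m) / 7) *
                  (max 0 (\<Delta> * delay_weight \<tau> m - 1 / (2 * real J)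
                    - sqrt (max 0 (log_threshold B C \<tau> m J) / (2 * (real \<tau> + real m)))))\<^sup>2)))"
proof -
  interpret change_point_model M \<tau> F0 F1 X U by fact
  note bound = late_alarm_bound[OF assms(1,2) _ _ assms(4,5) assms(7)[unfolded assms(6)] assms(8,10), of _ _ B]
  show ?thesis
  \<comment> \<open>The first claim is the case \<open>n = m\<close> of the bound. For the second,
    every \<open>m\<close> in \<open>{1..n}\<close> bounds the same event at time
    \<open>\<tau> + n\<close>, hence so does the infimum.\<close>
  proof (intro conjI allI impI cINF_greatest)
    fix m :: nat assume "1 \<le> m"
    then show "measure M {\<omega> \<in> space M. kt_alarm J B (\<lambda>t. pval X U t \<omega>) > enat (\<tau> + m)}
              \<le> exp (- (2 * (real \<tau> + real m) / 7) *
                  (max 0 (\<Delta> * delay_weight \<tau> m - 1 / (2 * real J)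
                    - sqrt (max 0 (log_threshold B C \<tau> m J) / (2 * (real \<tau> + real m)))))\<^sup>2)"
      by (rule bound) simp
  next
    fix n :: nat assume "1 \<le> n"
    then show "{1..n} \<noteq> {}" by simp
  next
    fix n m :: nat assume "m \<in> {1..n}"
    then show "measure M {\<omega> \<in> space M. kt_alarm J B (\<lambda>t. pval X U t \<omega>) > enat (\<tau> + n)}
              \<le> exp (- (2 * (real \<tau> + real m) / 7) *
                  (max 0 (\<Delta> * delay_weight \<tau> m - 1 / (2 * real J)
                    - sqrt (max 0 (log_threshold B C \<tau> m J) / (2 * (real \<tau> + real m)))))\<^sup>2)"
      by (intro bound) auto
  qed
qed

end
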